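(* Let $1\le r<n$, let $\hat\Omega\in\mathbb{S}^n_+$ with $\operatorname{rank}(\hat\Omega)=r$, and let $\Sigma\in\mathcal{S}_{\hat\Omega}$. Consider $$(P)\qquad \min_{\Omega\in\mathbb{S}^n}\{\|\Sigma-\Omega\|_F^2 \mid \operatorname{rank}(\Omega)\le r,\ \Sigma\ge\Omega\ge 0,\ \Sigma-\Omega\in\mathbb{D}^n\},$$ $$(D)\qquad \max_{\Lambda\in\mathbb{S}^n_0}\{-\|\Sigma+\Lambda\|_r^2+2\langle\Lambda,\Sigma\rangle+\|\Sigma\|_F^2\}.$$ Then the solutions to $(D)$ solve $(P)$, in the sense that for every solution $\Lambda$ of $(D)$ there is an $\Omega\in\operatorname{svd}_r(\Sigma+\Lambda)$ that solves $(P)$. Moreover, the optimal values of $(P)$ and $(D)$ are equal, the optimum of $(P)$ is attained at $\Omega^\star=\hat\Omega$, and the optimum of $(D)$ is attained at some $\Lambda^\star\in\mathbb{S}^n_0$ satisfying $$\|\Lambda^\star+\Sigma-\hat\Omega\|<\sigma_r(\hat\Omega)\quad\text{and}\quad \mathcal{R}(\Lambda^\star+\Sigma-\hat\Omega)\perp\mathcal{R}(\hat\Omega).$$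
   Context: All matrices are real. $\mathbb{S}^n$: symmetric $n\times n$ matrices; $\mathbb{S}^n_0$: symmetric matrices with zero diagonal; $\mathbb{S}^n_+$: symmetric positive semidefinite matrices; $\mathbb{D}^n$: diagonal matrices; $\mathbb{D}^n_+$: diagonal matrices with nonnegative entries. $A\ge B$ (resp. $A>0$) means $A-B$ is positive semidefinite (resp. $A$ is positive definite). $\langle A,B\rangle=\operatorname{tr}(A^TB)$. $\mathcal{R}(A)$ is the range of $A$. Singular values $\sigma_1(A)\ge\sigma_2(A)\ge\cdots$ are in nonincreasing order; $\|A\|=\sigma_1(A)$ is the spectral norm, $\|A\|_F$ the Frobenius norm, and $\|A\|_r=\sqrt{\sum_{i=1}^r\sigma_i^2(A)}$. For $A\in\mathbb{R}^{n\times n}$, $$\operatorname{svd}_r(A)=\Big\{\sum_{i=1}^r\sigma_i(A)u_iv_i^T \ \Big|\ A=\sum_{i=1}^n\sigma_i(A)u_iv_i^T\ \text{is a singular value decomposition}\Big\},$$ where in a singular value decomposition $(u_i)$ and $(v_i)$ are orthonormal. For $\hat\Omega\in\mathbb{S}^n_+$ of rank $r$, $$\mathcal{D}_{\hat\Omega}=\{\Delta\in\mathbb{D}^n_+ \mid \exists\,\Lambda\in\mathbb{S}^n_0:\ \|\Delta+\Lambda\|<\sigma_r(\hat\Omega),\ \mathcal{R}(\Delta+\Lambda)\perp\mathcal{R}(\hat\Omega)\},$$ $$\mathcal{S}_{\hat\Omega}=\{\Sigma=\hat\Omega+\Delta>0 \mid \Delta\in\mathcal{D}_{\hat\Omega}\}.$$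 *)

theory Defs
  imports "HOL-Analysis.Analysis" "HOL-Computational_Algebra.Polynomial"
begin

definition sym_mats :: "(real^'n^'n) set" where
  "sym_mats = {A. transpose A = A}"

definition sym0_mats :: "(real^'n^'n) set" where
  "sym0_mats = {A \<in> sym_mats. \<forall>i. A $ i $ i = 0}"

definition psd_mats :: "(real^'n^'n) set" where
  "psd_mats = {A \<in> sym_mats. \<forall>x. 0 \<le> x \<bullet> (A *v x)}"

definition pd_mats :: "(real^'n^'n) set" where
  "pd_mats = {A \<in> sym_mats. \<forall>x. x \<noteq> 0 \<longrightarrow> 0 < x \<bullet> (A *v x)}"

definition diag_mats :: "(real^'n^'n) set" where
  "diag_mats = {A. \<forall>i j. i \<noteq> j \<longrightarrow> A $ i $ j = 0}"

definition nonneg_diag_mats :: "(real^'n^'n) set" where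
  "nonneg_diag_mats = {A \<in> diag_mats. \<forall>i. 0 \<le> A $ i $ i}"

definition mat_range :: "real^'n^'m \<Rightarrow> (real^'m) set" where
  "mat_range A = range (\<lambda>x. A *v x)"

definition orthogonal_sets :: "'a::real_inner set \<Rightarrow> 'a set \<Rightarrow> bool" where
  "orthogonal_sets U V \<longleftrightarrow> (\<forall>u\<in>U. \<forall>v\<in>V. orthogonal u v)"

definition mat_inner :: "real^'n^'n \<Rightarrow> real^'n^'n \<Rightarrow> real" where
  "mat_inner A B = trace (transpose A ** B)"

text \<open>The library's norm on \<^typ>\<open>real^'n^'n\<close> is the Frobenius norm.\<close>

lemma norm_eq_frobenius: "norm A = sqrt (mat_inner A A)"
proof -
  have "A \<bullet> A = (\<Sum>i\<in>UNIV. \<Sum>j\<in>UNIV. A $ i $ j * A $ i $ j)"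
    by (simp add: inner_vec_def)
  also have "\<dots> = (\<Sum>j\<in>UNIV. \<Sum>i\<in>UNIV. A $ i $ j * A $ i $ j)"
    by (rule sum.swap)
  also have "\<dots> = mat_inner A A"
    by (simp add: mat_inner_def trace_def transpose_def matrix_matrix_mult_def)
  finally show ?thesis by (simp add: norm_eq_sqrt_inner)
qed

definition char_poly_mat :: "real^'n^'n \<Rightarrow> real poly" where
  "char_poly_mat A = det (\<chi> i j. (if i = j then [:0, 1:] else 0) - [:A $ i $ j:])"

text \<open>
  The singular values are the square roots of the eigenvalues of the Gram matrix, i.e. of the
  roots of its characteristic polynomial counted with multiplicity, in nonincreasing order.
  As that matrix is positive semidefinite, its characteristic polynomial splits over the reals
  into factors with nonnegative roots, so the list has length \<^term>\<open>CARD('n)\<close>.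
\<close>

definition singular_values :: "real^'n^'n \<Rightarrow> real list" where
  "singular_values A =
     rev (sorted_list_of_multiset (image_mset sqrt (proots (char_poly_mat (transpose A ** A)))))"

text \<open>Singular values are numbered from 1.\<close>

definition singular_value :: "real^'n^'n \<Rightarrow> nat \<Rightarrow> real" where
  "singular_value A i = singular_values A ! (i - 1)"

definition spectral_norm :: "real^'n^'n \<Rightarrow> real" where
  "spectral_norm A = singular_value A 1"

definition r_norm :: "nat \<Rightarrow> real^'n^'n \<Rightarrow> real" where
  "r_norm r A = sqrt (\<Sum>i=1..r. (singular_value A i)\<^sup>2)"

definition outer_prod :: "real^'n \<Rightarrow> real^'n \<Rightarrow> real^'n^'n" where
  "outer_prod u v = (\<chi> i j. u $ i * v $ j)"

definition orthonormal_family :: "nat set \<Rightarrow> (nat \<Rightarrow> 'a::real_inner) \<Rightarrow> bool" where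
  "orthonormal_family I u \<longleftrightarrow> (\<forall>i\<in>I. \<forall>j\<in>I. u i \<bullet> u j = (if i = j then 1 else 0))"

definition is_svd :: "real^'n^'n \<Rightarrow> (nat \<Rightarrow> real^'n) \<Rightarrow> (nat \<Rightarrow> real^'n) \<Rightarrow> bool" where
  "is_svd A u v \<longleftrightarrow>
     orthonormal_family {1..CARD('n)} u \<and> orthonormal_family {1..CARD('n)} v \<and>
     A = (\<Sum>i=1..CARD('n). singular_value A i *\<^sub>R outer_prod (u i) (v i))"

definition svd_trunc :: "nat \<Rightarrow> real^'n^'n \<Rightarrow> (real^'n^'n) set" where
  "svd_trunc r A = {\<Sum>i=1..r. singular_value A i *\<^sub>R outer_prod (u i) (v i) | u v. is_svd A u v}"

definition D_class :: "real^'n^'n \<Rightarrow> (real^'n^'n) set" where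
  "D_class W = {\<Delta> \<in> nonneg_diag_mats. \<exists>\<Lambda> \<in> sym0_mats.
     spectral_norm (\<Delta> + \<Lambda>) < singular_value W (rank W) \<and>
     orthogonal_sets (mat_range (\<Delta> + \<Lambda>)) (mat_range W)}"

definition S_class :: "real^'n^'n \<Rightarrow> (real^'n^'n) set" where
  "S_class W = {W + \<Delta> | \<Delta>. \<Delta> \<in> D_class W \<and> W + \<Delta> \<in> pd_mats}"

definition P_feasible :: "nat \<Rightarrow> real^'n^'n \<Rightarrow> (real^'n^'n) set" where
  "P_feasible r S = {W \<in> sym_mats. rank W \<le> r \<and> S - W \<in> psd_mats \<and> W \<in> psd_mats \<and>
     S - W \<in> diag_mats}"

definition P_obj :: "real^'n^'n \<Rightarrow> real^'n^'n \<Rightarrow> real" where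
  "P_obj S W = (norm (S - W))\<^sup>2"

definition D_obj :: "nat \<Rightarrow> real^'n^'n \<Rightarrow> real^'n^'n \<Rightarrow> real" where
  "D_obj r S \<Lambda> = - (r_norm r (S + \<Lambda>))\<^sup>2 + 2 * mat_inner \<Lambda> S + (norm S)\<^sup>2"

definition solves_P :: "nat \<Rightarrow> real^'n^'n \<Rightarrow> real^'n^'n \<Rightarrow> bool" where
  "solves_P r S W \<longleftrightarrow> is_arg_min (P_obj S) (\<lambda>X. X \<in> P_feasible r S) W"

definition solves_D :: "nat \<Rightarrow> real^'n^'n \<Rightarrow> real^'n^'n \<Rightarrow> bool" where
  "solves_D r S \<Lambda> \<longleftrightarrow> is_arg_max (D_obj r S) (\<lambda>X. X \<in> sym0_mats) \<Lambda>"

end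

theory Submission
  imports Defs
begin

text \<open>
  For \<open>\<Omega>\<close> feasible for (P) and \<open>\<Lambda>\<close> with zero diagonal, \<open>\<langle>\<Lambda>, \<Sigma> - \<Omega>\<rangle> = 0\<close>, so with \<open>A = \<Sigma> + \<Lambda>\<close> the
  duality gap is \<open>|\<Omega>|\<^sup>2 - 2\<langle>A, \<Omega>\<rangle> + |A|\<^sub>r\<^sup>2\<close>. Writing \<open>\<Omega> = \<Sum> \<lambda>\<^sub>w w w\<^sup>T\<close> over an orthonormal set of at most
  \<open>r\<close> vectors, the gap is at least \<open>\<Sum> |A w - \<lambda>\<^sub>w w|\<^sup>2\<close>, because \<open>\<Sum> |A w|\<^sup>2 \<le> |A|\<^sub>r\<^sup>2\<close>. If the gap
  vanishes and \<open>\<Omega>\<close> has rank exactly \<open>r\<close>, the \<open>w\<close> are therefore eigenvectors of \<open>A\<close>, and they belong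
  to \<open>r\<close> largest eigenvalues in modulus, so that \<open>\<Omega> \<in> svd\<^sub>r(A)\<close>.
  The certificate \<open>\<Lambda>\<close> in the definition of \<open>\<D>\<close> makes the gap of \<open>\<Omega>h\<close> zero; hence \<open>\<Omega>h\<close> has zero
  gap with every solution of (D), and the first claim holds with \<open>\<Omega> = \<Omega>h\<close>.
\<close>

section \<open>Orthonormal sets in Euclidean spaces\<close>

definition orthonormal_set :: "'a::real_inner set \<Rightarrow> bool" where
  "orthonormal_set B \<longleftrightarrow> (\<forall>x\<in>B. \<forall>y\<in>B. x \<bullet> y = (if x = y then 1 else 0))"

text \<open>Deliberately not divided by \<open>x \<bullet> x\<close>: it serves on unit vectors,
  where it is the Rayleigh quotient and, at an eigenvector, the eigenvalue. Eigenvalues thus need no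
  function of their own.\<close>

definition rayleigh :: "real^'n^'n \<Rightarrow> real^'n \<Rightarrow> real" where
  "rayleigh A x = x \<bullet> (A *v x)"

definition eigenvectors :: "real^'n^'n \<Rightarrow> (real^'n) set" where
  "eigenvectors A = {x. A *v x = rayleigh A x *\<^sub>R x}"

text \<open>A set rather than an indexed family, so that bases can be extended and split freely; an
  enumeration is chosen only where the order of the singular values matters.\<close>

definition eigenbasis :: "real^'n^'n \<Rightarrow> (real^'n) set \<Rightarrow> bool" where
  "eigenbasis A B \<longleftrightarrow> orthonormal_set B \<and> card B = CARD('n) \<and> B \<subseteq> eigenvectors A"

lemma orthonormal_set_subset: "orthonormal_set B \<Longrightarrow> C \<subseteq> B \<Longrightarrow> orthonormal_set C"
  by (auto simp: orthonormal_set_def subset_iff)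

lemma orthonormal_set_inner:
  "orthonormal_set B \<Longrightarrow> x \<in> B \<Longrightarrow> y \<in> B \<Longrightarrow> x \<bullet> y = (if x = y then 1 else 0)"
  by (auto simp: orthonormal_set_def)

lemma orthonormal_set_norm: "orthonormal_set B \<Longrightarrow> x \<in> B \<Longrightarrow> norm x = 1"
  by (simp add: norm_eq_sqrt_inner orthonormal_set_def)

lemma orthonormal_set_pairwise: "orthonormal_set B \<Longrightarrow> pairwise orthogonal B"
  by (auto simp: orthonormal_set_def pairwise_def orthogonal_def)

lemma orthonormal_set_independent: "orthonormal_set B \<Longrightarrow> independent B"
  for B :: "'a::euclidean_space set"
  by (rule pairwise_orthogonal_independent)
     (auto simp: orthonormal_set_pairwise dest: orthonormal_set_norm)

lemma orthonormal_set_finite: "orthonormal_set B \<Longrightarrow> finite B"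
  for B :: "'a::euclidean_space set"
  using independent_imp_finite orthonormal_set_independent by blast

lemma orthonormal_set_card_le: "orthonormal_set B \<Longrightarrow> card B \<le> DIM('a)"
  for B :: "'a::euclidean_space set"
  using independent_bound orthonormal_set_independent by blast

lemma orthonormal_set_span_UNIV:
  fixes B :: "'a::euclidean_space set"
  assumes "orthonormal_set B" "card B = DIM('a)"
  shows "span B = UNIV"
  using card_ge_dim_independent[of B UNIV] orthonormal_set_independent[OF assms(1)] assms(2)
  by auto

lemma orthonormal_set_expand:
  fixes B :: "'a::euclidean_space set"
  assumes "orthonormal_set B" "card B = DIM('a)"
  shows "(\<Sum>b\<in>B. (x \<bullet> b) *\<^sub>R b) = x"
  by (rule orthonormal_basis_expand)
     (use assms in \<open>auto simp: orthonormal_set_pairwise orthonormal_set_norm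
        orthonormal_set_span_UNIV orthonormal_set_finite\<close>)

lemma orthonormal_set_parseval:
  fixes B :: "'a::euclidean_space set"
  assumes "orthonormal_set B" "card B = DIM('a)"
  shows "(\<Sum>b\<in>B. (x \<bullet> b)\<^sup>2) = x \<bullet> x"
proof -
  have "x \<bullet> x = x \<bullet> (\<Sum>b\<in>B. (x \<bullet> b) *\<^sub>R b)"
    using orthonormal_set_expand[OF assms] by simp
  then show ?thesis by (simp add: inner_sum_right power2_eq_square)
qed

lemma orthonormal_set_bessel:
  fixes B :: "'a::euclidean_space set"
  assumes "orthonormal_set B"
  shows "(\<Sum>b\<in>B. (x \<bullet> b)\<^sup>2) \<le> x \<bullet> x"
proof -
  define p where "p = (\<Sum>b\<in>B. (x \<bullet> b) *\<^sub>R b)"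
  have fin: "finite B" using assms by (rule orthonormal_set_finite)
  have xp: "x \<bullet> p = (\<Sum>b\<in>B. (x \<bullet> b)\<^sup>2)"
    by (simp add: p_def inner_sum_right power2_eq_square)
  have bp: "b \<bullet> p = x \<bullet> b" if "b \<in> B" for b
  proof -
    have "b \<bullet> p = (\<Sum>c\<in>B. if b = c then x \<bullet> c else 0)"
      unfolding p_def inner_sum_right
      by (rule sum.cong) (use that assms in \<open>auto simp: orthonormal_set_inner\<close>)
    then show ?thesis using that fin by simp
  qed
  have "p \<bullet> p = (\<Sum>b\<in>B. (x \<bullet> b) * (b \<bullet> p))"
    by (subst p_def) (simp add: inner_sum_left)
  also have "\<dots> = (\<Sum>b\<in>B. (x \<bullet> b)\<^sup>2)"
    by (rule sum.cong) (simp_all add: bp power2_eq_square)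
  finally have pp: "p \<bullet> p = (\<Sum>b\<in>B. (x \<bullet> b)\<^sup>2)" .
  have "0 \<le> (x - p) \<bullet> (x - p)" by simp
  then show ?thesis using xp pp by (simp add: inner_diff inner_commute)
qed

section \<open>The spectral theorem for symmetric matrices\<close>

lemma inner_sym_matrix:
  assumes "transpose A = A"
  shows "x \<bullet> (A *v y) = (A *v x) \<bullet> (y::real^'n)"
  using dot_lmul_matrix[of x A y] vector_transpose_matrix[of x A] assms
  by (metis transpose_transpose)

text \<open>Optimality of the Rayleigh quotient along \<open>x + t z\<close>, where
  \<open>z = A x - \<mu> x\<close> is the residual, gives \<open>2 t |z|\<^sup>2 \<le> t\<^sup>2 K\<close> for all \<open>t\<close>, hence \<open>z = 0\<close>.\<close>

lemma rayleigh_maximizer_eigenvector: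
  fixes A :: "real^'n^'n"
  assumes sym: "transpose A = A"
    and U: "subspace U" and inv: "\<And>x. x \<in> U \<Longrightarrow> A *v x \<in> U"
    and x: "x \<in> U" "norm x = 1"
    and max: "\<And>y. y \<in> U \<Longrightarrow> norm y = 1 \<Longrightarrow> rayleigh A y \<le> rayleigh A x"
  shows "x \<in> eigenvectors A"
proof -
  define m where "m = rayleigh A x"
  define z where "z = A *v x - m *\<^sub>R x"
  define K where "K = m * (z \<bullet> z) - z \<bullet> (A *v z)"
  have zU: "z \<in> U" unfolding z_def using U inv x by (simp add: subspace_diff subspace_scale)
  have xx: "x \<bullet> x = 1" using x(2) by (simp add: norm_eq_1)
  have le: "y \<bullet> (A *v y) \<le> m * (y \<bullet> y)" if "y \<in> U" for y
  proof (cases "y = 0")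
    case False
    let ?y = "(1 / norm y) *\<^sub>R y"
    have "rayleigh A ?y \<le> m" unfolding m_def
      by (rule max) (use that U False in \<open>auto simp: subspace_scale\<close>)
    moreover have "rayleigh A ?y = y \<bullet> (A *v y) / (norm y)\<^sup>2"
      by (simp add: rayleigh_def matrix_vector_mult_scaleR power2_eq_square)
    ultimately show ?thesis using False
      by (simp add: divide_le_eq power2_norm_eq_inner)
  qed simp
  have zx: "z \<bullet> x = 0" unfolding z_def m_def rayleigh_def
    by (simp add: inner_diff_left xx inner_commute inner_diff_right)
  have zAx: "z \<bullet> (A *v x) = z \<bullet> z"
    using zx by (simp add: z_def inner_diff_right)
  have xAz: "x \<bullet> (A *v z) = z \<bullet> z"
    using zAx inner_sym_matrix[OF sym, of x z] by (simp add: inner_commute)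
  have "2 * t * (z \<bullet> z) \<le> t\<^sup>2 * K" for t
  proof -
    have "x + t *\<^sub>R z \<in> U" using U x zU by (simp add: subspace_add subspace_scale)
    from le[OF this] show ?thesis
      by (simp add: K_def inner_add matrix_vector_right_distrib matrix_vector_mult_scaleR zx xx
          zAx xAz inner_commute[of x z] algebra_simps power2_eq_square m_def[symmetric]
          rayleigh_def[symmetric])
  qed
  note q = this
  have "z \<bullet> z = 0"
  proof (rule ccontr)
    assume "z \<bullet> z \<noteq> 0"
    then have pos: "z \<bullet> z > 0" by (simp add: less_le)
    \<comment> \<open>With this step size \<open>t * (\<bar>K\<bar> + 1)\<close> is exactly
      \<open>z \<bullet> z\<close>, half of what the inequality would require; the summand 1 keeps
      the denominator positive when \<open>K\<close> is 0.\<close>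
    define t where "t = (z \<bullet> z) / (\<bar>K\<bar> + 1)"
    have t: "t > 0" using pos by (simp add: t_def add_nonneg_pos)
    have "2 * (z \<bullet> z) \<le> t * K" using q[of t] t by (simp add: power2_eq_square)
    also have "\<dots> \<le> t * (\<bar>K\<bar> + 1)" using t by (intro mult_left_mono) auto
    also have "\<dots> = z \<bullet> z" by (simp add: t_def add_nonneg_eq_0_iff)
    finally show False using pos by simp
  qed
  then have "A *v x = m *\<^sub>R x" by (simp add: z_def)
  then show ?thesis by (simp add: eigenvectors_def m_def)
qed

text \<open>By symmetry, the orthogonal complement \<open>U\<close> of a set of eigenvectors is
  invariant under \<open>A\<close>. Its unit sphere is compact and, as \<open>W\<close> does not
  span, nonempty; a maximizer of the Rayleigh quotient there is the new eigenvector.\<close>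

lemma eigenvectors_orthogonal_step:
  fixes A :: "real^'n^'n"
  assumes sym: "transpose A = A"
    and W: "orthonormal_set W" "W \<subseteq> eigenvectors A" "card W < CARD('n)"
  obtains x where "x \<notin> W" "orthonormal_set (insert x W)" "x \<in> eigenvectors A"
proof -
  define U where "U = {x. \<forall>w\<in>W. w \<bullet> x = 0}"
  have U: "subspace U" by (auto simp: U_def subspace_def inner_add_right)
  have inv: "A *v x \<in> U" if "x \<in> U" for x
  proof -
    have "w \<bullet> (A *v x) = 0" if "w \<in> W" for w
      using inner_sym_matrix[OF sym, of w x] W(2) that \<open>x \<in> U\<close>
      by (auto simp: U_def eigenvectors_def subset_iff)
    then show ?thesis by (simp add: U_def)
  qed
  have "span W \<noteq> UNIV"
    using W(3) dim_span_eq_card_independent[OF orthonormal_set_independent[OF W(1)]]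
    by (metis dim_UNIV DIM_cart DIM_real mult.right_neutral less_irrefl)
  then obtain a where a: "a \<noteq> 0" "\<forall>x\<in>span W. a \<bullet> x = 0"
    using span_not_UNIV_orthogonal by blast
  have aU: "a \<in> U" using a(2) by (auto simp: U_def inner_commute span_base)
  let ?T = "sphere 0 1 \<inter> U"
  have "compact ?T" using closed_subspace[OF U] by (simp add: compact_Int_closed)
  moreover have "(1 / norm a) *\<^sub>R a \<in> ?T" using a(1) aU U by (simp add: subspace_scale)
  moreover have "continuous_on ?T (rayleigh A)"
    unfolding rayleigh_def
    by (intro continuous_intros linear_continuous_on linear_linear[THEN iffD2]) auto
  ultimately obtain x where x: "x \<in> ?T" "\<forall>y\<in>?T. rayleigh A y \<le> rayleigh A x"
    using continuous_attains_sup[of ?T "rayleigh A"] by blast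
  have "x \<in> eigenvectors A"
    by (rule rayleigh_maximizer_eigenvector[OF sym U inv]) (use x in auto)
  moreover have xx: "x \<bullet> x = 1" using x by (simp add: norm_eq_1)
  moreover have "x \<notin> W" using x xx by (auto simp: U_def)
  moreover have "orthonormal_set (insert x W)"
    using W(1) x xx by (auto simp: orthonormal_set_def U_def inner_commute)
  ultimately show ?thesis using that by blast
qed

text \<open>The spectral theorem is the case of empty \<open>W\<close>. The general form lets a
  basis of one matrix start from eigenvectors found through another.\<close>

lemma eigenbasis_extend:
  fixes A :: "real^'n^'n"
  assumes sym: "transpose A = A" and W: "orthonormal_set W" "W \<subseteq> eigenvectors A"
  obtains B where "W \<subseteq> B" "eigenbasis A B"
proof -
  have "\<exists>B. W \<subseteq> B \<and> eigenbasis A B"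
    using W
  proof (induction "CARD('n) - card W" arbitrary: W rule: less_induct)
    case less
    show ?case
    proof (cases "card W < CARD('n)")
      case True
      obtain x where x: "x \<notin> W" "orthonormal_set (insert x W)" "x \<in> eigenvectors A"
        using eigenvectors_orthogonal_step[OF sym less.prems True] by blast
      have "CARD('n) - card (insert x W) < CARD('n) - card W"
        using x True orthonormal_set_finite[OF less.prems(1)] by simp
      then show ?thesis using less.hyps[of "insert x W"] x less.prems by auto
    next
      case False
      then have "card W = CARD('n)" using orthonormal_set_card_le[OF less.prems(1)] by simp
      then show ?thesis using less.prems by (auto simp: eigenbasis_def)
    qed
  qed
  then show ?thesis using that by blast
qed

lemma eigenvectorsI:
  assumes "A *v x = c *\<^sub>R x" "norm x = 1"
  shows "x \<in> eigenvectors A" "rayleigh A x = c"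
  using assms by (simp_all add: eigenvectors_def rayleigh_def norm_eq_1)

lemma eigenbasisD:
  assumes "eigenbasis A B"
  shows "orthonormal_set B" "card B = CARD('n)" "finite B"
    "\<And>b. b \<in> B \<Longrightarrow> A *v b = rayleigh A b *\<^sub>R (b::real^'n)"
  using assms orthonormal_set_finite by (auto simp: eigenbasis_def eigenvectors_def)

lemma sum_matrix_vector_mult: "(\<Sum>i\<in>I. M i) *v x = (\<Sum>i\<in>I. M i *v (x::real^'n))"
  by (induction I rule: infinite_finite_induct) (auto simp: matrix_vector_mult_add_rdistrib)

lemma outer_prod_mult_vector: "outer_prod u v *v x = (v \<bullet> x) *\<^sub>R u"
  by (simp add: vec_eq_iff outer_prod_def matrix_vector_mult_def inner_vec_def sum_distrib_left
      mult_ac)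

lemma inner_outer_prod: "A \<bullet> outer_prod u v = u \<bullet> (A *v v)"
  by (simp add: outer_prod_def matrix_vector_mult_def inner_vec_def sum_distrib_left mult_ac)

lemma mat_inner_eq_inner: "mat_inner A B = A \<bullet> B"
proof -
  have "mat_inner A B = (\<Sum>j\<in>UNIV. \<Sum>i\<in>UNIV. A $ i $ j * B $ i $ j)"
    by (simp add: mat_inner_def trace_def transpose_def matrix_matrix_mult_def)
  also have "\<dots> = A \<bullet> B" by (subst sum.swap) (simp add: inner_vec_def)
  finally show ?thesis .
qed

lemma eigenbasis_decomposition:
  fixes A :: "real^'n^'n"
  assumes "eigenbasis A B"
  shows "A = (\<Sum>b\<in>B. rayleigh A b *\<^sub>R outer_prod b b)"
proof -
  note B = eigenbasisD[OF assms]
  have "A *v x = (\<Sum>b\<in>B. rayleigh A b *\<^sub>R outer_prod b b) *v x" for x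
  proof -
    have "A *v x = A *v (\<Sum>b\<in>B. (x \<bullet> b) *\<^sub>R b)"
      using orthonormal_set_expand[OF B(1)] B(2) by simp
    also have "\<dots> = (\<Sum>b\<in>B. (x \<bullet> b) *\<^sub>R (A *v b))"
      by (simp add: linear_sum[OF matrix_vector_mul_linear] matrix_vector_mult_scaleR)
    also have "\<dots> = (\<Sum>b\<in>B. (rayleigh A b *\<^sub>R outer_prod b b) *v x)"
      by (rule sum.cong)
         (simp_all add: B(4) outer_prod_mult_vector inner_commute mult.commute
           flip: scaleR_matrix_vector_assoc)
    finally show ?thesis by (simp add: sum_matrix_vector_mult)
  qed
  then show ?thesis by (simp add: matrix_eq)
qed

section \<open>Characteristic polynomial and singular values of a symmetric matrix\<close>

lemma sum_const_poly: "(\<Sum>k\<in>I. [:g k:]) = [:\<Sum>k\<in>I. g k:]"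
  by (induction I rule: infinite_finite_induct) auto

text \<open>Diagonalization is carried out over the polynomial ring: with the eigenvectors as
  columns of \<open>Q\<close>, \<open>P ** Q = Q ** D\<close> for a diagonal \<open>D\<close>, and
  the nonzero \<open>det Q\<close> cancels in an integral domain.\<close>

lemma char_poly_mat_eigenbasis:
  fixes M :: "real^'n^'n"
  assumes "eigenbasis M B"
  shows "char_poly_mat M = (\<Prod>b\<in>B. [:- rayleigh M b, 1:])"
proof -
  note B = eigenbasisD[OF assms]
  obtain f where f: "bij_betw f (UNIV::'n set) B"
    using finite_same_card_bij[of "UNIV::'n set" B] B(2,3) by auto
  have fB: "f i \<in> B" for i using f by (auto simp: bij_betw_def)
  have orth: "f i \<bullet> f j = (if i = j then 1 else 0)" for i j
    using orthonormal_set_inner[OF B(1) fB fB, of i j] f by (auto simp: bij_betw_def inj_eq)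
  define X where "X = [:0, 1::real:]"
  define Q where "Q = (\<chi> i j. [:f j $ i:])"
  define R where "R = (\<chi> i j. [:f i $ j:])"
  define P where "P = (\<chi> i j. (if i = j then X else 0) - [:M $ i $ j:])"
  define D where "D = (\<chi> i j. if i = j then X - [:rayleigh M (f i):] else 0)"
  \<comment> \<open>\<open>R\<close> is the transpose of \<open>Q\<close>, so this is the
    orthonormality of the basis.\<close>
  have "R ** Q = mat 1"
    by (simp add: vec_eq_iff R_def Q_def matrix_matrix_mult_def sum_const_poly mat_def
        orth[unfolded inner_vec_def inner_real_def] one_pCons)
  then have "det R * det Q = 1" by (metis det_I det_mul)
  then have Q: "det Q \<noteq> 0" by auto
  have Mf: "(\<Sum>k\<in>UNIV. M $ i $ k * f j $ k) = rayleigh M (f j) * f j $ i" for i j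
    using B(4)[OF fB, of j] by (simp add: vec_eq_iff matrix_vector_mult_def)
  have "P ** Q = Q ** D"
  proof -
    have "(P ** Q) $ i $ j = (Q ** D) $ i $ j" for i j
    proof -
      have "(P ** Q) $ i $ j = (\<Sum>k\<in>UNIV. P $ i $ k * Q $ k $ j)"
        by (simp add: matrix_matrix_mult_def)
      also have "\<dots> = (\<Sum>k\<in>UNIV. (if i = k then X * [:f j $ k:] else 0) - [:M $ i $ k * f j $ k:])"
      proof (rule sum.cong)
        fix k
        have "P $ i $ k * Q $ k $ j = (if i = k then X else 0) * [:f j $ k:] - [:M $ i $ k:] * [:f j $ k:]"
          unfolding P_def Q_def by (simp only: vec_lambda_beta left_diff_distrib)
        then show "P $ i $ k * Q $ k $ j = (if i = k then X * [:f j $ k:] else 0) - [:M $ i $ k * f j $ k:]"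
          by (cases "i = k") simp_all
      qed simp
      also have "\<dots> = X * [:f j $ i:] - [:rayleigh M (f j) * f j $ i:]"
        by (simp add: sum_subtractf sum_const_poly Mf)
      also have "\<dots> = [:f j $ i:] * (X - [:rayleigh M (f j):])"
        by (simp add: X_def)
      also have "\<dots> = (\<Sum>k\<in>UNIV. if k = j then [:f j $ i:] * (X - [:rayleigh M (f j):]) else 0)"
        by simp
      also have "\<dots> = (\<Sum>k\<in>UNIV. Q $ i $ k * D $ k $ j)"
        by (rule sum.cong) (auto simp: Q_def D_def)
      also have "\<dots> = (Q ** D) $ i $ j"
        by (simp add: matrix_matrix_mult_def)
      finally show ?thesis .
    qed
    then show ?thesis by (simp add: vec_eq_iff)
  qed
  then have "det P * det Q = det Q * det D" by (metis det_mul)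
  then have "det P = det D" using Q by simp
  also have "det D = (\<Prod>i\<in>UNIV. X - [:rayleigh M (f i):])"
    by (subst det_diagonal) (auto simp: D_def)
  also have "\<dots> = (\<Prod>i\<in>UNIV. [:- rayleigh M (f i), 1:])" by (simp add: X_def)
  also have "\<dots> = (\<Prod>b\<in>B. [:- rayleigh M b, 1:])"
    by (rule prod.reindex_bij_betw[OF f])
  finally show ?thesis unfolding char_poly_mat_def P_def X_def .
qed

lemma proots_prod_linear_factors:
  fixes c :: "'b \<Rightarrow> 'a::idom"
  assumes "finite B"
  shows "proots (\<Prod>b\<in>B. [:- c b, 1:]) = image_mset c (mset_set B)"
proof -
  have "proots (\<Prod>b\<in>B. [:- c b, 1:]) = (\<Sum>b\<in>B. {#c b#})"
    by (subst proots_prod) auto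
  also have "\<dots> = image_mset c (mset_set B)"
    using assms by induction auto
  finally show ?thesis .
qed

text \<open>\<open>B\<close> also diagonalizes the Gram matrix, which is the square of
  \<open>A\<close>, and the square root of a squared eigenvalue is its modulus.\<close>

lemma singular_values_eigenbasis:
  fixes A :: "real^'n^'n"
  assumes sym: "transpose A = A" and B: "eigenbasis A B"
  shows "singular_values A =
    rev (sorted_list_of_multiset (image_mset (\<lambda>b. \<bar>rayleigh A b\<bar>) (mset_set B)))"
proof -
  let ?M = "transpose A ** A"
  note B' = eigenbasisD[OF B]
  have M: "?M *v b = (rayleigh A b)\<^sup>2 *\<^sub>R b" if "b \<in> B" for b
    using B'(4)[OF that]
    by (simp add: sym matrix_vector_mult_scaleR power2_eq_square flip: matrix_vector_mul_assoc)
  have ray: "rayleigh ?M b = (rayleigh A b)\<^sup>2" if "b \<in> B" for b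
    by (rule eigenvectorsI(2)[OF M[OF that]]) (use that B'(1) orthonormal_set_norm in auto)
  have "eigenbasis ?M B" unfolding eigenbasis_def
    using B'(1,2) by (auto intro!: eigenvectorsI(1)[OF M] orthonormal_set_norm)
  then have "proots (char_poly_mat ?M) = image_mset (rayleigh ?M) (mset_set B)"
    using B'(3) by (simp add: char_poly_mat_eigenbasis proots_prod_linear_factors)
  also have "\<dots> = image_mset (\<lambda>b. (rayleigh A b)\<^sup>2) (mset_set B)"
    by (rule image_mset_cong) (use B'(3) ray in auto)
  finally show ?thesis
    by (simp add: singular_values_def image_mset.compositionality o_def)
qed

text \<open>Links eigenvectors to positions in the list of singular values. The two blocks are
  sorted separately and concatenated; since \<open>W\<close> dominates \<open>V\<close>, the result
  is sorted, and ties between the blocks are resolved in favour of \<open>W\<close>.\<close>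

lemma ordered_eigenbasis:
  fixes A :: "real^'n^'n"
  assumes sym: "transpose A = A" and B: "eigenbasis A (W \<union> V)" and disj: "W \<inter> V = {}"
    and le: "\<And>w v. w \<in> W \<Longrightarrow> v \<in> V \<Longrightarrow> \<bar>rayleigh A v\<bar> \<le> \<bar>rayleigh A w\<bar>"
  obtains e :: "nat \<Rightarrow> real^'n" where "bij_betw e {1..CARD('n)} (W \<union> V)"
    "bij_betw e {1..card W} W"
    "\<And>i. 1 \<le> i \<Longrightarrow> i \<le> CARD('n) \<Longrightarrow> singular_value A i = \<bar>rayleigh A (e i)\<bar>"
    "\<And>i j. 1 \<le> i \<Longrightarrow> i \<le> j \<Longrightarrow> j \<le> CARD('n) \<Longrightarrow> singular_value A j \<le> singular_value A i"
proof -
  note B' = eigenbasisD[OF B]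
  define c where "c b = \<bar>rayleigh A b\<bar>" for b
  have *: "\<exists>L. distinct L \<and> set L = C \<and> sorted_wrt (\<lambda>x y. c y \<le> c x) L" if fin: "finite C" for C
  proof -
    obtain L where L: "set L = C" "distinct L" using finite_distinct_list[OF fin] by blast
    \<comment> \<open>The negated key turns the ascending sort into a descending one.\<close>
    have "sorted (map (\<lambda>b. - c b) (sort_key (\<lambda>b. - c b) L))" by simp
    then have "sorted_wrt (\<lambda>x y. c y \<le> c x) (sort_key (\<lambda>b. - c b) L)"
      by (simp add: sorted_wrt_map)
    then show ?thesis using L by (intro exI[of _ "sort_key (\<lambda>b. - c b) L"]) auto
  qed
  obtain L1 where L1: "distinct L1" "set L1 = W" "sorted_wrt (\<lambda>x y. c y \<le> c x) L1"
    using *[of W] B'(3) by auto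
  obtain L2 where L2: "distinct L2" "set L2 = V" "sorted_wrt (\<lambda>x y. c y \<le> c x) L2"
    using *[of V] B'(3) by auto
  define L where "L = L1 @ L2"
  have L: "distinct L" "set L = W \<union> V" using L1 L2 disj by (auto simp: L_def)
  have len: "length L = CARD('n)" using L B'(2) by (metis distinct_card)
  have len1: "length L1 = card W" using L1 by (metis distinct_card)
  have srt: "sorted_wrt (\<lambda>x y. c y \<le> c x) L"
    using L1 L2 le by (auto simp: L_def sorted_wrt_append c_def)
  have "singular_values A = rev (sorted_list_of_multiset (image_mset c (mset_set (W \<union> V))))"
    using singular_values_eigenbasis[OF sym B] by (simp add: c_def[abs_def])
  also have "image_mset c (mset_set (W \<union> V)) = mset (map c L)"
    using L by (metis mset_map mset_set_set)
  also have "sorted_list_of_multiset \<dots> = rev (map c L)"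
    unfolding sorted_list_of_multiset_mset
    by (rule properties_for_sort) (use srt in \<open>simp_all add: sorted_wrt_rev sorted_wrt_map\<close>)
  finally have sv: "singular_values A = map c L" by simp
  \<comment> \<open>Lists are indexed from 0, singular values from 1.\<close>
  define e where "e i = L ! (i - 1)" for i
  have shift: "bij_betw (\<lambda>i. i - 1) {1..m} {..<m::nat}" for m
    by (rule bij_betwI[where g = Suc]) auto
  have "bij_betw ((!) L \<circ> (\<lambda>i. i - 1)) {1..CARD('n)} (W \<union> V)"
    by (rule bij_betw_trans[OF shift]) (rule bij_betw_nth; use L len in auto)
  then have 1: "bij_betw e {1..CARD('n)} (W \<union> V)" by (simp add: e_def[abs_def] o_def)
  have "bij_betw ((!) L1 \<circ> (\<lambda>i. i - 1)) {1..card W} W"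
    by (rule bij_betw_trans[OF shift]) (rule bij_betw_nth; use L1 len1 in auto)
  moreover have "((!) L1 \<circ> (\<lambda>i. i - 1)) i = e i" if "i \<in> {1..card W}" for i
    using that len1 by (auto simp: e_def L_def nth_append)
  ultimately have 2: "bij_betw e {1..card W} W" by (rule bij_betw_cong[THEN iffD1, rotated])
  have 3: "singular_value A i = \<bar>rayleigh A (e i)\<bar>" if "1 \<le> i" "i \<le> CARD('n)" for i
    using that len by (simp add: singular_value_def sv e_def c_def)
  have 4: "singular_value A j \<le> singular_value A i" if "1 \<le> i" "i \<le> j" "j \<le> CARD('n)" for i j
  proof (cases "i = j")
    case False
    then show ?thesis using that len sorted_wrt_nth_less[OF srt, of "i - 1" "j - 1"]
      by (simp add: singular_value_def sv)
  qed simp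
  show ?thesis by (rule that[OF 1 2 3 4])
qed

section \<open>The Ky Fan maximum principle for the squared matrix\<close>

lemma r_norm_sq: "(r_norm r A)\<^sup>2 = (\<Sum>i=1..r. (singular_value A i)\<^sup>2)"
  by (simp add: r_norm_def sum_nonneg)

lemma sorted_eigenbasis:
  fixes A :: "real^'n^'n"
  assumes sym: "transpose A = A" and B: "eigenbasis A B"
  obtains e :: "nat \<Rightarrow> real^'n" where "bij_betw e {1..CARD('n)} B"
    "\<And>i. 1 \<le> i \<Longrightarrow> i \<le> CARD('n) \<Longrightarrow> singular_value A i = \<bar>rayleigh A (e i)\<bar>"
    "\<And>i j. 1 \<le> i \<Longrightarrow> i \<le> j \<Longrightarrow> j \<le> CARD('n) \<Longrightarrow> singular_value A j \<le> singular_value A i"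
proof (rule ordered_eigenbasis[OF sym, of "{}" B])
  fix e :: "nat \<Rightarrow> real^'n"
  assume "bij_betw e {1..CARD('n)} ({} \<union> B)"
    and sv: "\<And>i. 1 \<le> i \<Longrightarrow> i \<le> CARD('n) \<Longrightarrow> singular_value A i = \<bar>rayleigh A (e i)\<bar>"
    and mono: "\<And>i j. 1 \<le> i \<Longrightarrow> i \<le> j \<Longrightarrow> j \<le> CARD('n) \<Longrightarrow> singular_value A j \<le> singular_value A i"
  then have "bij_betw e {1..CARD('n)} B" by simp
  then show thesis by (rule that[OF _ sv mono])
qed (use B in auto)

text \<open>In a sorted eigenbasis the left side is a weighted sum of the squared singular values.
  The weights lie between 0 and 1 and add up to at most \<open>r\<close>, so the sum is largest when
  the weight sits on the first \<open>r\<close> places.\<close>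

lemma sum_norm_sq_le_r_norm:
  fixes A :: "real^'n^'n"
  assumes sym: "transpose A = A" and W: "orthonormal_set W" "card W \<le> r"
    and r: "1 \<le> r" "r \<le> CARD('n)"
  shows "(\<Sum>w\<in>W. (norm (A *v w))\<^sup>2) \<le> (r_norm r A)\<^sup>2"
proof -
  obtain B where B: "eigenbasis A B"
    using eigenbasis_extend[OF sym, of "{}"] by (auto simp: orthonormal_set_def)
  note B' = eigenbasisD[OF B]
  obtain e where e: "bij_betw e {1..CARD('n)} B"
    and sv: "\<And>i. 1 \<le> i \<Longrightarrow> i \<le> CARD('n) \<Longrightarrow> singular_value A i = \<bar>rayleigh A (e i)\<bar>"
    and mono: "\<And>i j. 1 \<le> i \<Longrightarrow> i \<le> j \<Longrightarrow> j \<le> CARD('n) \<Longrightarrow> singular_value A j \<le> singular_value A i"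
    using sorted_eigenbasis[OF sym B] by blast
  define q where "q i = (singular_value A i)\<^sup>2" for i
  \<comment> \<open>The squared length of the projection of \<open>e i\<close> onto the span of
    \<open>W\<close>: at most 1 by Bessel, with total \<open>card W\<close> by Parseval.\<close>
  define t where "t i = (\<Sum>w\<in>W. (w \<bullet> e i)\<^sup>2)" for i
  have eB: "e i \<in> B" if "i \<in> {1..CARD('n)}" for i using e that by (auto simp: bij_betw_def)
  have q_mono: "q j \<le> q i" if "1 \<le> i" "i \<le> j" "j \<le> CARD('n)" for i j
    unfolding q_def using that mono[OF that] sv[of j] by (intro power_mono) auto
  have t1: "t i \<le> 1" if "i \<in> {1..CARD('n)}" for i
    using orthonormal_set_bessel[OF W(1), of "e i"] orthonormal_set_norm[OF B'(1) eB[OF that]]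
    by (simp add: t_def inner_commute norm_eq_1)
  have t0: "t i \<ge> 0" for i by (simp add: t_def sum_nonneg)
  have parseval: "(\<Sum>i=1..CARD('n). (x \<bullet> e i)\<^sup>2) = x \<bullet> x" for x
    using orthonormal_set_parseval[OF B'(1), of x] B'(2)
      sum.reindex_bij_betw[OF e, of "\<lambda>b. (x \<bullet> b)\<^sup>2"] by simp
  have "(\<Sum>i=1..CARD('n). t i) = (\<Sum>w\<in>W. w \<bullet> w)"
    unfolding t_def by (subst sum.swap) (simp only: parseval)
  also have "\<dots> = card W" using orthonormal_set_norm[OF W(1)] by (simp add: norm_eq_1)
  finally have tsum: "(\<Sum>i=1..CARD('n). t i) \<le> r" using W(2) by simp
  have Aw: "(norm (A *v w))\<^sup>2 = (\<Sum>i=1..CARD('n). q i * (w \<bullet> e i)\<^sup>2)" for w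
  proof -
    have "(norm (A *v w))\<^sup>2 = (\<Sum>i=1..CARD('n). ((A *v w) \<bullet> e i)\<^sup>2)"
      by (simp only: parseval power2_norm_eq_inner)
    also have "\<dots> = (\<Sum>i=1..CARD('n). q i * (w \<bullet> e i)\<^sup>2)"
    proof (rule sum.cong)
      fix i assume i: "i \<in> {1..CARD('n)}"
      have "(A *v w) \<bullet> e i = rayleigh A (e i) * (w \<bullet> e i)"
        using inner_sym_matrix[OF sym, of w "e i"] B'(4)[OF eB[OF i]] by simp
      then show "((A *v w) \<bullet> e i)\<^sup>2 = q i * (w \<bullet> e i)\<^sup>2"
        using sv[of i] i by (simp add: q_def power_mult_distrib)
    qed simp
    finally show ?thesis .
  qed
  have "(\<Sum>w\<in>W. (norm (A *v w))\<^sup>2) = (\<Sum>i=1..CARD('n). q i * t i)"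
    unfolding Aw by (subst sum.swap) (simp add: t_def sum_distrib_left)
  \<comment> \<open>Subtracting the pivot \<open>q r\<close> makes the coefficients nonnegative up
    to place \<open>r\<close> and nonpositive after it, so weights may be raised to 1 in the first
    range and dropped in the second.\<close>
  also have "\<dots> = (\<Sum>i=1..CARD('n). (q i - q r) * t i) + q r * (\<Sum>i=1..CARD('n). t i)"
    by (simp add: sum_distrib_left left_diff_distrib sum_subtractf)
  also have "\<dots> \<le> (\<Sum>i=1..r. q i - q r) + q r * r"
  proof (rule add_mono)
    have "(\<Sum>i=1..CARD('n). (q i - q r) * t i) \<le>
        (\<Sum>i=1..CARD('n). if i \<in> {1..r} then q i - q r else 0)"
    proof (rule sum_mono)
      fix i assume i: "i \<in> {1..CARD('n)}"
      show "(q i - q r) * t i \<le> (if i \<in> {1..r} then q i - q r else 0)"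
      proof (cases "i \<le> r")
        case True
        then show ?thesis
          using q_mono[of i r] i r t1[OF i] mult_left_mono[of "t i" 1 "q i - q r"] by simp
      next
        case False
        then show ?thesis
          using q_mono[of r i] i r t0[of i] by (simp add: mult_nonpos_nonneg)
      qed
    qed
    also have "\<dots> = (\<Sum>i=1..r. q i - q r)"
      using r by (intro sum.mono_neutral_cong_right) auto
    finally show "(\<Sum>i=1..CARD('n). (q i - q r) * t i) \<le> (\<Sum>i=1..r. q i - q r)" .
    show "q r * (\<Sum>i=1..CARD('n). t i) \<le> q r * r"
      using tsum by (intro mult_left_mono) (auto simp: q_def)
  qed
  also have "\<dots> = (r_norm r A)\<^sup>2"
    by (simp add: r_norm_sq q_def sum_subtractf)
  finally show ?thesis .
qed

section \<open>Compact spectral decompositions and low-rank approximation\<close>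

definition spectral_frame :: "real^'n^'n \<Rightarrow> (real^'n) set \<Rightarrow> bool" where
  "spectral_frame A W \<longleftrightarrow> orthonormal_set W \<and> W \<subseteq> eigenvectors A \<and> card W = rank A \<and>
     (\<forall>w\<in>W. rayleigh A w \<noteq> 0) \<and> W \<subseteq> mat_range A \<and> A = (\<Sum>w\<in>W. rayleigh A w *\<^sub>R outer_prod w w)"

text \<open>The members of an eigenbasis with nonzero eigenvalue carry the whole decomposition and
  span the range, so their number is the rank.\<close>

lemma spectral_frame_exists:
  fixes A :: "real^'n^'n"
  assumes sym: "transpose A = A"
  obtains W where "spectral_frame A W"
proof -
  obtain B where B: "eigenbasis A B"
    using eigenbasis_extend[OF sym, of "{}"] by (auto simp: orthonormal_set_def)
  note B' = eigenbasisD[OF B]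
  define W where "W = {b \<in> B. rayleigh A b \<noteq> 0}"
  have sub: "W \<subseteq> B" by (auto simp: W_def)
  have orth: "orthonormal_set W" using orthonormal_set_subset[OF B'(1) sub] .
  have "(\<Sum>b\<in>B. rayleigh A b *\<^sub>R outer_prod b b) = (\<Sum>w\<in>W. rayleigh A w *\<^sub>R outer_prod w w)"
    by (rule sum.mono_neutral_right) (use B'(3) in \<open>auto simp: W_def\<close>)
  then have dec: "A = (\<Sum>w\<in>W. rayleigh A w *\<^sub>R outer_prod w w)"
    using eigenbasis_decomposition[OF B] by metis
  have rng: "W \<subseteq> mat_range A"
  proof
    fix w assume w: "w \<in> W"
    then have "A *v ((1 / rayleigh A w) *\<^sub>R w) = w"
      using B'(4)[of w] by (simp add: W_def matrix_vector_mult_scaleR)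
    then show "w \<in> mat_range A" unfolding mat_range_def by (metis rangeI)
  qed
  have "A *v x \<in> span W" for x
  proof -
    have "A *v x = (\<Sum>w\<in>W. (rayleigh A w * (w \<bullet> x)) *\<^sub>R w)"
      by (subst dec) (simp add: sum_matrix_vector_mult outer_prod_mult_vector
          flip: scaleR_matrix_vector_assoc)
    then show ?thesis by (simp add: span_sum span_scale span_base)
  qed
  then have "span (mat_range A) = span W"
    unfolding span_eq using rng by (auto simp: mat_range_def intro: span_base)
  then have "rank A = dim W"
    by (metis dim_span mat_range_def rank_dim_range)
  also have "\<dots> = card W"
    by (rule dim_eq_card_independent[OF orthonormal_set_independent[OF orth]])
  finally have "rank A = card W" .
  then have "spectral_frame A W"
    using B orth rng dec sub by (auto simp: spectral_frame_def eigenbasis_def W_def)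
  then show ?thesis by (rule that)
qed

text \<open>With \<open>M = A\<close> this gives the squared Frobenius norm as the sum of the
  squared eigenvalues.\<close>

lemma spectral_frame_inner:
  fixes M :: "real^'n^'n"
  assumes "spectral_frame A W"
  shows "M \<bullet> A = (\<Sum>w\<in>W. rayleigh A w * rayleigh M w)"
proof -
  have "M \<bullet> A = M \<bullet> (\<Sum>w\<in>W. rayleigh A w *\<^sub>R outer_prod w w)"
    using assms unfolding spectral_frame_def by metis
  then show ?thesis by (simp add: inner_sum_right inner_outer_prod rayleigh_def)
qed

text \<open>The Eckart--Young bound, with the defect that vanishes exactly when \<open>W\<close> consists of
  eigenvectors of \<open>A\<close> for the eigenvalues of \<open>M\<close>.\<close>

lemma low_rank_defect:
  fixes A M :: "real^'n^'n"
  assumes sym: "transpose A = A" and M: "spectral_frame M W" and rank: "rank M \<le> r"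
    and r: "1 \<le> r" "r \<le> CARD('n)"
  shows "(\<Sum>w\<in>W. (norm (A *v w - rayleigh M w *\<^sub>R w))\<^sup>2) \<le> (norm M)\<^sup>2 - 2 * (A \<bullet> M) + (r_norm r A)\<^sup>2"
proof -
  have W: "orthonormal_set W" "card W = rank M" using M by (auto simp: spectral_frame_def)
  have "(norm M)\<^sup>2 = (\<Sum>w\<in>W. (rayleigh M w)\<^sup>2)"
    unfolding power2_norm_eq_inner spectral_frame_inner[OF M] by (simp add: power2_eq_square)
  moreover have "(\<Sum>w\<in>W. (norm (A *v w - rayleigh M w *\<^sub>R w))\<^sup>2) =
      (\<Sum>w\<in>W. (norm (A *v w))\<^sup>2 - 2 * (rayleigh M w * rayleigh A w) + (rayleigh M w)\<^sup>2)"
  proof (rule sum.cong)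
    fix w assume "w \<in> W"
    then have "w \<bullet> w = 1" using orthonormal_set_norm[OF W(1)] by (simp add: norm_eq_1)
    then show "(norm (A *v w - rayleigh M w *\<^sub>R w))\<^sup>2 =
        (norm (A *v w))\<^sup>2 - 2 * (rayleigh M w * rayleigh A w) + (rayleigh M w)\<^sup>2"
      unfolding power2_norm_eq_inner rayleigh_def
      by (simp add: inner_diff inner_commute power2_eq_square)
  qed simp
  moreover have "\<dots> = (\<Sum>w\<in>W. (norm (A *v w))\<^sup>2) - 2 * (A \<bullet> M) + (\<Sum>w\<in>W. (rayleigh M w)\<^sup>2)"
    by (simp add: spectral_frame_inner[OF M, of A] sum.distrib sum_subtractf sum_distrib_left)
  ultimately show ?thesis
    using sum_norm_sq_le_r_norm[OF sym W(1), of r] W(2) rank r by simp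
qed

section \<open>Singular value decompositions read off from eigenbases\<close>

text \<open>The left singular vectors are the eigenvectors themselves; the right ones absorb the
  signs of the eigenvalues.\<close>

lemma eigenbasis_is_svd:
  fixes A :: "real^'n^'n"
  assumes B: "eigenbasis A B" and e: "bij_betw e {1..CARD('n)} B"
    and sv: "\<And>i. 1 \<le> i \<Longrightarrow> i \<le> CARD('n) \<Longrightarrow> singular_value A i = \<bar>rayleigh A (e i)\<bar>"
    and s: "\<And>b. s b = (if rayleigh A b < 0 then -1 else 1)"
  shows "is_svd A e (\<lambda>i. s (e i) *\<^sub>R e i)"
proof -
  note B' = eigenbasisD[OF B]
  have "orthonormal_family {1..CARD('n)} e"
    using B'(1) e by (auto simp: orthonormal_family_def orthonormal_set_inner bij_betw_def inj_on_eq_iff)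
  moreover from this have "orthonormal_family {1..CARD('n)} (\<lambda>i. s (e i) *\<^sub>R e i)"
    by (auto simp: orthonormal_family_def s)
  moreover have "A = (\<Sum>i=1..CARD('n). singular_value A i *\<^sub>R outer_prod (e i) (s (e i) *\<^sub>R e i))"
  proof -
    have "(\<Sum>i=1..CARD('n). singular_value A i *\<^sub>R outer_prod (e i) (s (e i) *\<^sub>R e i)) =
        (\<Sum>i=1..CARD('n). rayleigh A (e i) *\<^sub>R outer_prod (e i) (e i))"
      by (rule sum.cong) (auto simp: sv s outer_prod_def vec_eq_iff)
    also have "\<dots> = (\<Sum>b\<in>B. rayleigh A b *\<^sub>R outer_prod b b)"
      by (rule sum.reindex_bij_betw[OF e])
    also have "\<dots> = A" by (rule eigenbasis_decomposition[OF B, symmetric])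
    finally show ?thesis by simp
  qed
  ultimately show ?thesis by (simp add: is_svd_def)
qed

lemma abs_rayleigh_le_spectral_norm:
  fixes A :: "real^'n^'n"
  assumes sym: "transpose A = A" and B: "eigenbasis A B" and b: "b \<in> B"
  shows "\<bar>rayleigh A b\<bar> \<le> spectral_norm A"
proof -
  obtain e where e: "bij_betw e {1..CARD('n)} B"
    and sv: "\<And>i. 1 \<le> i \<Longrightarrow> i \<le> CARD('n) \<Longrightarrow> singular_value A i = \<bar>rayleigh A (e i)\<bar>"
    and mono: "\<And>i j. 1 \<le> i \<Longrightarrow> i \<le> j \<Longrightarrow> j \<le> CARD('n) \<Longrightarrow> singular_value A j \<le> singular_value A i"
    using sorted_eigenbasis[OF sym B] by blast
  obtain i where "1 \<le> i" "i \<le> CARD('n)" "e i = b"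
    using e b unfolding bij_betw_def by (metis atLeastAtMost_iff imageE)
  then show ?thesis using sv[of i] mono[of 1 i] by (simp add: spectral_norm_def)
qed

text \<open>A dominating block fills the first \<open>card W\<close> places, and the last of these
  holds its smallest modulus.\<close>

lemma singular_value_card_le:
  fixes A :: "real^'n^'n"
  assumes sym: "transpose A = A" and B: "eigenbasis A (W \<union> V)" and disj: "W \<inter> V = {}"
    and le: "\<And>w v. w \<in> W \<Longrightarrow> v \<in> V \<Longrightarrow> \<bar>rayleigh A v\<bar> \<le> \<bar>rayleigh A w\<bar>"
    and w: "w \<in> W"
  shows "singular_value A (card W) \<le> \<bar>rayleigh A w\<bar>"
proof -
  have card: "card W \<le> CARD('n)"
    using eigenbasisD(2,3)[OF B] by (metis card_mono sup_ge1)
  obtain e where e: "bij_betw e {1..card W} W"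
    and sv: "\<And>i. 1 \<le> i \<Longrightarrow> i \<le> CARD('n) \<Longrightarrow> singular_value A i = \<bar>rayleigh A (e i)\<bar>"
    and mono: "\<And>i j. 1 \<le> i \<Longrightarrow> i \<le> j \<Longrightarrow> j \<le> CARD('n) \<Longrightarrow> singular_value A j \<le> singular_value A i"
    using ordered_eigenbasis[OF sym B disj le] by metis
  obtain i where "1 \<le> i" "i \<le> card W" "e i = w"
    using e w unfolding bij_betw_def by (metis atLeastAtMost_iff imageE)
  then show ?thesis using sv[of i] mono[of i "card W"] card by simp
qed

lemma r_norm_sq_eigenbasis:
  fixes A :: "real^'n^'n"
  assumes sym: "transpose A = A" and B: "eigenbasis A (W \<union> V)" and disj: "W \<inter> V = {}"
    and le: "\<And>w v. w \<in> W \<Longrightarrow> v \<in> V \<Longrightarrow> \<bar>rayleigh A v\<bar> \<le> \<bar>rayleigh A w\<bar>"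
  shows "(r_norm (card W) A)\<^sup>2 = (\<Sum>w\<in>W. (rayleigh A w)\<^sup>2)"
proof -
  have card: "card W \<le> CARD('n)"
    using eigenbasisD(2,3)[OF B] by (metis card_mono sup_ge1)
  obtain e where e: "bij_betw e {1..card W} W"
    and sv: "\<And>i. 1 \<le> i \<Longrightarrow> i \<le> CARD('n) \<Longrightarrow> singular_value A i = \<bar>rayleigh A (e i)\<bar>"
    using ordered_eigenbasis[OF sym B disj le] by metis
  have "(r_norm (card W) A)\<^sup>2 = (\<Sum>i=1..card W. (rayleigh A (e i))\<^sup>2)"
    unfolding r_norm_sq by (rule sum.cong) (use sv card in auto)
  also have "\<dots> = (\<Sum>w\<in>W. (rayleigh A w)\<^sup>2)"
    by (rule sum.reindex_bij_betw[OF e])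
  finally show ?thesis .
qed

text \<open>The equality case of the low-rank bound: a spectral frame of \<open>M\<close> consists
  of eigenvectors of \<open>A\<close> with the same eigenvalues, and these can be placed first in a
  singular value decomposition of \<open>A\<close>.\<close>

lemma zero_defect_svd_trunc:
  fixes A M :: "real^'n^'n"
  assumes sym: "transpose A = A" and symM: "transpose M = M"
    and r: "1 \<le> rank M"
    and opt: "(norm M)\<^sup>2 - 2 * (A \<bullet> M) + (r_norm (rank M) A)\<^sup>2 = 0"
  shows "M \<in> svd_trunc (rank M) A"
proof -
  obtain W where M: "spectral_frame M W" using spectral_frame_exists[OF symM] .
  then have W: "orthonormal_set W" "card W = rank M"
    and dec: "M = (\<Sum>w\<in>W. rayleigh M w *\<^sub>R outer_prod w w)"
    by (auto simp: spectral_frame_def)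
  have fin: "finite W" using W(1) by (rule orthonormal_set_finite)
  have rn: "rank M \<le> CARD('n)" using rank_bound[of M] by simp
  have "(\<Sum>w\<in>W. (norm (A *v w - rayleigh M w *\<^sub>R w))\<^sup>2) \<le> 0"
    using low_rank_defect[OF sym M order_refl r rn] opt by simp
  then have "(\<Sum>w\<in>W. (norm (A *v w - rayleigh M w *\<^sub>R w))\<^sup>2) = 0"
    by (intro antisym sum_nonneg) auto
  then have Aw: "A *v w = rayleigh M w *\<^sub>R w" if "w \<in> W" for w
    using that fin by (simp add: sum_nonneg_eq_0_iff)
  have ray: "rayleigh A w = rayleigh M w" if "w \<in> W" for w
    using eigenvectorsI(2)[OF Aw[OF that]] orthonormal_set_norm[OF W(1) that] by simp
  have "W \<subseteq> eigenvectors A"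
    using Aw orthonormal_set_norm[OF W(1)] by (auto intro: eigenvectorsI(1))
  then obtain B where B: "W \<subseteq> B" "eigenbasis A B" using eigenbasis_extend[OF sym W(1)] by blast
  note B' = eigenbasisD[OF B(2)]
  have "A \<bullet> M = (\<Sum>w\<in>W. (rayleigh M w)\<^sup>2)" "(norm M)\<^sup>2 = (\<Sum>w\<in>W. (rayleigh M w)\<^sup>2)"
    unfolding power2_norm_eq_inner spectral_frame_inner[OF M]
    by (simp_all add: power2_eq_square ray)
  \<comment> \<open>So \<open>W\<close> attains the Ky Fan bound, which is what the exchange
    argument below relies on.\<close>
  then have rsq: "(r_norm (rank M) A)\<^sup>2 = (\<Sum>w\<in>W. (rayleigh A w)\<^sup>2)" using opt ray by simp
  have nsq: "(norm (A *v b))\<^sup>2 = (rayleigh A b)\<^sup>2" if "b \<in> B" for b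
    using B'(4)[OF that] orthonormal_set_norm[OF B'(1) that] by simp
  \<comment> \<open>Otherwise exchanging \<open>w\<close> for \<open>v\<close> would violate the bound on sums over \<open>r\<close> orthonormal vectors.\<close>
  have le: "\<bar>rayleigh A v\<bar> \<le> \<bar>rayleigh A w\<bar>" if w: "w \<in> W" and v: "v \<in> B - W" for w v
  proof -
    let ?W = "insert v (W - {w})"
    have sub: "?W \<subseteq> B" using B(1) v by auto
    have "card ?W = rank M" using w v fin W(2) r by simp
    then have "(\<Sum>x\<in>?W. (norm (A *v x))\<^sup>2) \<le> (r_norm (rank M) A)\<^sup>2"
      using sum_norm_sq_le_r_norm[OF sym orthonormal_set_subset[OF B'(1) sub], of "rank M"] r rn
      by simp
    moreover have "(\<Sum>x\<in>?W. (norm (A *v x))\<^sup>2) = (\<Sum>x\<in>?W. (rayleigh A x)\<^sup>2)"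
      by (rule sum.cong) (use sub nsq in auto)
    moreover have "\<dots> = (rayleigh A v)\<^sup>2 + (\<Sum>x\<in>W - {w}. (rayleigh A x)\<^sup>2)"
      using v fin by (subst sum.insert) auto
    moreover have "(\<Sum>x\<in>W. (rayleigh A x)\<^sup>2) = (rayleigh A w)\<^sup>2 + (\<Sum>x\<in>W - {w}. (rayleigh A x)\<^sup>2)"
      by (rule sum.remove[OF fin w])
    ultimately have "(rayleigh A v)\<^sup>2 \<le> (rayleigh A w)\<^sup>2" using rsq by simp
    then show ?thesis by (simp add: abs_le_square_iff)
  qed
  have WB: "W \<union> (B - W) = B" using B(1) by auto
  then have B2: "eigenbasis A (W \<union> (B - W))" using B(2) by simp
  obtain e where e: "bij_betw e {1..CARD('n)} B" "bij_betw e {1..card W} W"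
    and sv: "\<And>i. 1 \<le> i \<Longrightarrow> i \<le> CARD('n) \<Longrightarrow> singular_value A i = \<bar>rayleigh A (e i)\<bar>"
    using ordered_eigenbasis[OF sym B2 _ le] WB by (metis Diff_disjoint)
  define s where "s b = (if rayleigh A b < 0 then -1 else 1 :: real)" for b
  have svd: "is_svd A e (\<lambda>i. s (e i) *\<^sub>R e i)"
    by (rule eigenbasis_is_svd[OF B(2) e(1) sv]) (simp_all add: s_def)
  have "(\<Sum>i=1..rank M. singular_value A i *\<^sub>R outer_prod (e i) (s (e i) *\<^sub>R e i)) =
      (\<Sum>i=1..card W. rayleigh A (e i) *\<^sub>R outer_prod (e i) (e i))"
    by (rule sum.cong) (use rn sv W(2) in \<open>auto simp: s_def outer_prod_def vec_eq_iff\<close>)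
  also have "\<dots> = (\<Sum>w\<in>W. rayleigh A w *\<^sub>R outer_prod w w)"
    by (rule sum.reindex_bij_betw[OF e(2)])
  also have "\<dots> = M" using dec ray by simp
  finally show ?thesis using svd unfolding svd_trunc_def
    by (intro CollectI exI[of _ e] exI[of _ "\<lambda>i. s (e i) *\<^sub>R e i"] conjI) simp_all
qed

section \<open>The duality gap between (P) and (D)\<close>

text \<open>\<open>L\<close> lives off the diagonal and \<open>S - M\<close> on it, so they are
  orthogonal; this turns the term in \<open>L\<close> and \<open>S\<close> into one in
  \<open>L\<close> and \<open>M\<close>, which completes the inner product with
  \<open>S + L\<close>.\<close>

lemma duality_gap:
  fixes S M L :: "real^'n^'n"
  assumes "S - M \<in> diag_mats" "L \<in> sym0_mats"
  shows "P_obj S M - D_obj r S L = (norm M)\<^sup>2 - 2 * ((S + L) \<bullet> M) + (r_norm r (S + L))\<^sup>2"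
proof -
  have "L $ i $ j * (S - M) $ i $ j = 0" for i j
    using assms by (cases "i = j") (simp_all add: sym0_mats_def diag_mats_def)
  then have "L \<bullet> (S - M) = 0" unfolding inner_vec_def inner_real_def by (intro sum.neutral ballI)
  then show ?thesis
    by (simp add: P_obj_def D_obj_def mat_inner_eq_inner power2_norm_eq_inner inner_diff
        inner_add_left inner_commute[of M S])
qed

lemma transpose_add: "transpose (A + B) = transpose A + transpose (B::real^'n^'m)"
  by (simp add: transpose_def vec_eq_iff)

text \<open>The gap is bounded below by the defect of \<open>M\<close>, a sum of squares.\<close>

lemma weak_duality:
  fixes S M L :: "real^'n^'n"
  assumes "S \<in> sym_mats" "M \<in> P_feasible r S" "L \<in> sym0_mats" "1 \<le> r" "r \<le> CARD('n)"
  shows "D_obj r S L \<le> P_obj S M"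
proof -
  have M: "transpose M = M" "rank M \<le> r" "S - M \<in> diag_mats"
    using assms(2) by (auto simp: P_feasible_def sym_mats_def)
  have sym: "transpose (S + L) = S + L"
    using assms(1,3) by (simp add: transpose_add sym_mats_def sym0_mats_def)
  obtain W where W: "spectral_frame M W" using spectral_frame_exists[OF M(1)] .
  have "0 \<le> (\<Sum>w\<in>W. (norm ((S + L) *v w - rayleigh M w *\<^sub>R w))\<^sup>2)"
    by (simp add: sum_nonneg)
  then show ?thesis
    using low_rank_defect[OF sym W M(2) assms(4,5)] duality_gap[OF M(3) assms(3), of r] by simp
qed

section \<open>Feasibility and the zero gap provided by the certificate\<close>

lemma nonneg_diag_mats_psd:
  assumes "D \<in> nonneg_diag_mats"
  shows "D \<in> psd_mats"
proof -
  have off: "D $ i $ j = 0" if "i \<noteq> j" for i j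
    using assms that by (auto simp: nonneg_diag_mats_def diag_mats_def)
  have "(D *v x) $ i = D $ i $ i * x $ i" for x i
  proof -
    have "(D *v x) $ i = (\<Sum>j\<in>UNIV. if i = j then D $ i $ i * x $ i else 0)"
      unfolding matrix_vector_mult_def vec_lambda_beta
      by (rule sum.cong) (use off in auto)
    then show ?thesis by simp
  qed
  then have "x \<bullet> (D *v x) = (\<Sum>i\<in>UNIV. D $ i $ i * (x $ i)\<^sup>2)" for x
    by (simp add: inner_vec_def power2_eq_square mult_ac)
  then have "0 \<le> x \<bullet> (D *v x)" for x
    using assms by (simp add: sum_nonneg nonneg_diag_mats_def)
  moreover have "transpose D = D"
    unfolding transpose_def vec_eq_iff vec_lambda_beta by (metis off)
  ultimately show ?thesis by (simp add: psd_mats_def sym_mats_def)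
qed

lemma rayleigh_add: "rayleigh (A + B) x = rayleigh A x + rayleigh B x"
  by (simp add: rayleigh_def matrix_vector_mult_add_rdistrib inner_add_right)

text \<open>The condition on \<open>M\<close> places the eigenvalues of \<open>A\<close> before those of \<open>M\<close> in the spectrum
  of \<open>A + M\<close>, so that truncating \<open>A + M\<close> at \<open>rank A\<close> gives back \<open>A\<close>.\<close>

lemma orthogonal_perturbation_zero_defect:
  fixes A M :: "real^'n^'n"
  assumes symA: "transpose A = A" and symM: "transpose M = M"
    and small: "spectral_norm M < singular_value A (rank A)"
    and orth: "orthogonal_sets (mat_range M) (mat_range A)"
  shows "(norm A)\<^sup>2 - 2 * ((A + M) \<bullet> A) + (r_norm (rank A) (A + M))\<^sup>2 = 0"
proof -
  obtain W where A: "spectral_frame A W" using spectral_frame_exists[OF symA] .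
  then have W: "orthonormal_set W" "card W = rank A" "W \<subseteq> mat_range A"
    "W \<subseteq> eigenvectors A"
    and dec: "A = (\<Sum>w\<in>W. rayleigh A w *\<^sub>R outer_prod w w)"
    by (auto simp: spectral_frame_def)
  \<comment> \<open>As \<open>w\<close> lies in the range of \<open>A\<close>, it is orthogonal to
    \<open>M *v (M *v w)\<close>; by symmetry of \<open>M\<close> that inner product is the squared
    norm of \<open>M *v w\<close>.\<close>
  have Mw: "M *v w = 0" if "w \<in> W" for w
  proof -
    have "(M *v (M *v w)) \<bullet> w = 0"
      using orth W(3) that by (auto simp: orthogonal_sets_def orthogonal_def mat_range_def)
    then show ?thesis using inner_sym_matrix[OF symM, of "M *v w" w] by simp
  qed
  have "w \<in> eigenvectors M" if "w \<in> W" for w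
    using Mw[OF that] by (simp add: eigenvectors_def rayleigh_def)
  then obtain B where B: "W \<subseteq> B" "eigenbasis M B"
    using eigenbasis_extend[OF symM W(1)] by blast
  define V where "V = B - W"
  note B' = eigenbasisD[OF B(2)]
  have WV: "W \<union> V = B" "W \<inter> V = {}" using B(1) by (auto simp: V_def)
  have Av: "A *v v = 0" if "v \<in> V" for v
  proof -
    have "w \<bullet> v = 0" if "w \<in> W" for w
      using orthonormal_set_inner[OF B'(1), of w v] \<open>v \<in> V\<close> that B(1) by (auto simp: V_def)
    then show ?thesis
      by (subst dec) (simp add: sum_matrix_vector_mult outer_prod_mult_vector
          flip: scaleR_matrix_vector_assoc)
  qed
  have rAv: "rayleigh A v = 0" if "v \<in> V" for v using Av[OF that] by (simp add: rayleigh_def)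
  have rMw: "rayleigh M w = 0" if "w \<in> W" for w using Mw[OF that] by (simp add: rayleigh_def)
  have eigA: "eigenbasis A (W \<union> V)"
    using B'(1,2) W(4) Av WV by (auto simp: eigenbasis_def eigenvectors_def rayleigh_def)
  have eigAM: "eigenbasis (A + M) (W \<union> V)"
    using eigenbasisD[OF eigA] B'(4) WV(1)
    by (auto simp: eigenbasis_def eigenvectors_def rayleigh_add matrix_vector_mult_add_rdistrib
        scaleR_add_left)
  have symAM: "transpose (A + M) = A + M" by (simp add: transpose_add symA symM)
  have sv: "singular_value A (rank A) \<le> \<bar>rayleigh A w\<bar>" if "w \<in> W" for w
    using singular_value_card_le[OF symA eigA WV(2) _ that] rAv W(2) by simp
  \<comment> \<open>On the common eigenbasis the sum has the eigenvalues of \<open>A\<close> on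
    \<open>W\<close> and those of \<open>M\<close> on \<open>V\<close>; the number
    \<open>singular_value A (rank A)\<close> separates their moduli.\<close>
  have le: "\<bar>rayleigh (A + M) v\<bar> \<le> \<bar>rayleigh (A + M) w\<bar>" if "w \<in> W" "v \<in> V" for w v
    using sv[OF that(1)] abs_rayleigh_le_spectral_norm[OF symM B(2), of v] small that WV(1)
    by (auto simp: rayleigh_add rAv rMw)
  have "(r_norm (rank A) (A + M))\<^sup>2 = (\<Sum>w\<in>W. (rayleigh A w)\<^sup>2)"
    using r_norm_sq_eigenbasis[OF symAM eigAM WV(2) le] W(2) by (simp add: rayleigh_add rMw)
  moreover have "(A + M) \<bullet> A = (\<Sum>w\<in>W. (rayleigh A w)\<^sup>2)" "(norm A)\<^sup>2 = (\<Sum>w\<in>W. (rayleigh A w)\<^sup>2)"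
    unfolding power2_norm_eq_inner spectral_frame_inner[OF A]
    by (simp_all add: rayleigh_add rMw power2_eq_square)
  ultimately show ?thesis by simp
qed

section \<open>Strong duality and recovery of a primal solution\<close>

theorem theorem2:
  fixes \<Omega>h S :: "real^'n^'n" and r :: nat
  assumes "1 \<le> r" and "r < CARD('n)"
    and "\<Omega>h \<in> psd_mats" and "rank \<Omega>h = r"
    and "S \<in> S_class \<Omega>h"
  shows "(\<forall>\<Lambda>. solves_D r S \<Lambda> \<longrightarrow> (\<exists>\<Omega> \<in> svd_trunc r (S + \<Lambda>). solves_P r S \<Omega>))
    \<and> (INF \<Omega> \<in> P_feasible r S. P_obj S \<Omega>) = (SUP \<Lambda> \<in> sym0_mats. D_obj r S \<Lambda>)
    \<and> solves_P r S \<Omega>h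
    \<and> (\<exists>\<Lambda> \<in> sym0_mats. solves_D r S \<Lambda>
          \<and> spectral_norm (\<Lambda> + S - \<Omega>h) < singular_value \<Omega>h r
          \<and> orthogonal_sets (mat_range (\<Lambda> + S - \<Omega>h)) (mat_range \<Omega>h))"
proof -
  obtain \<Delta> where S: "S = \<Omega>h + \<Delta>" and \<Delta>: "\<Delta> \<in> D_class \<Omega>h" and pd: "S \<in> pd_mats"
    using assms(5) by (auto simp: S_class_def)
  obtain \<Lambda> where \<Lambda>: "\<Lambda> \<in> sym0_mats" "spectral_norm (\<Delta> + \<Lambda>) < singular_value \<Omega>h r"
    "orthogonal_sets (mat_range (\<Delta> + \<Lambda>)) (mat_range \<Omega>h)" and nd: "\<Delta> \<in> nonneg_diag_mats"
    using \<Delta> assms(4) by (auto simp: D_class_def)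
  have \<Delta>_psd: "\<Delta> \<in> psd_mats" using nd by (rule nonneg_diag_mats_psd)
  have S_sym: "S \<in> sym_mats" using pd by (simp add: pd_mats_def)
  have \<Omega>_sym: "transpose \<Omega>h = \<Omega>h" using assms(3) by (simp add: psd_mats_def sym_mats_def)
  have M_sym: "transpose (\<Delta> + \<Lambda>) = \<Delta> + \<Lambda>"
    using \<Delta>_psd \<Lambda>(1) by (simp add: transpose_add psd_mats_def sym0_mats_def sym_mats_def)
  have diag: "S - \<Omega>h \<in> diag_mats" using nd by (simp add: S nonneg_diag_mats_def)
  have feas: "\<Omega>h \<in> P_feasible r S"
    using assms(3,4) \<Delta>_psd diag by (simp add: P_feasible_def psd_mats_def S)
  have SL: "S + \<Lambda> = \<Omega>h + (\<Delta> + \<Lambda>)" by (simp add: S)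
  \<comment> \<open>The certificate \<open>\<Lambda>\<close> closes the gap with
    \<open>\<Omega>h\<close>; by weak duality both are then optimal.\<close>
  have eq: "P_obj S \<Omega>h = D_obj r S \<Lambda>"
    using orthogonal_perturbation_zero_defect[OF \<Omega>_sym M_sym] \<Lambda> assms(4)
      duality_gap[OF diag \<Lambda>(1), of r] by (simp add: SL)
  have weak: "D_obj r S L \<le> P_obj S X" if "X \<in> P_feasible r S" "L \<in> sym0_mats" for X L
    using weak_duality[OF S_sym that assms(1)] assms(2) by simp
  have solP: "solves_P r S \<Omega>h"
    unfolding solves_P_def is_arg_min_linorder using feas weak \<Lambda>(1) eq by metis
  have D_le: "D_obj r S L \<le> D_obj r S \<Lambda>" if "L \<in> sym0_mats" for L
    using weak[OF feas that] eq by simp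
  have solD: "solves_D r S \<Lambda>"
    unfolding solves_D_def is_arg_max_linorder using \<Lambda>(1) D_le by blast
  \<comment> \<open>Both extrema are attained, so \<open>INF\<close> and \<open>SUP\<close> over the
    reals are a true minimum and maximum.\<close>
  have "(INF \<Omega> \<in> P_feasible r S. P_obj S \<Omega>) = P_obj S \<Omega>h"
    by (rule cInf_eq_minimum) (use feas in blast, use weak \<Lambda>(1) eq in auto)
  moreover have "(SUP \<Lambda> \<in> sym0_mats. D_obj r S \<Lambda>) = D_obj r S \<Lambda>"
    by (rule cSup_eq_maximum) (use \<Lambda>(1) D_le in auto)
  moreover have "\<Omega>h \<in> svd_trunc r (S + L)" if "solves_D r S L" for L
  proof -
    have L: "L \<in> sym0_mats" "D_obj r S \<Lambda> \<le> D_obj r S L"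
      using that \<Lambda>(1) by (auto simp: solves_D_def is_arg_max_linorder)
    have sym: "transpose (S + L) = S + L"
      using S_sym L(1) by (simp add: transpose_add sym_mats_def sym0_mats_def)
    \<comment> \<open>An arbitrary dual solution \<open>L\<close> has the same value as
      \<open>\<Lambda>\<close>, so its gap with \<open>\<Omega>h\<close> also vanishes, and the
      equality case applies because \<open>\<Omega>h\<close> has rank exactly
      \<open>r\<close>.\<close>
    have "P_obj S \<Omega>h - D_obj r S L = 0" using L D_le[OF L(1)] eq by simp
    then show ?thesis
      using zero_defect_svd_trunc[OF sym \<Omega>_sym] duality_gap[OF diag L(1), of r] assms(1,4)
      by simp
  qed
  moreover have "\<exists>\<Lambda> \<in> sym0_mats. solves_D r S \<Lambda>
      \<and> spectral_norm (\<Lambda> + S - \<Omega>h) < singular_value \<Omega>h r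
      \<and> orthogonal_sets (mat_range (\<Lambda> + S - \<Omega>h)) (mat_range \<Omega>h)"
    by (rule bexI[OF _ \<Lambda>(1)]) (use solD \<Lambda> in \<open>simp add: S add.commute\<close>)
  ultimately show ?thesis using solP eq by auto
qed

end
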